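(* For each $n\ge1$ let $p^{(n)}=(p^{(n)}_1,\dots,p^{(n)}_n)$ be a probability measure on $n$ points, such that $\lim_{n\to\infty}p^{(n)}_k=0$ for all $k\ge1$, and let $(x_n)_{n\ge1}$ be a sequence of points in a Hadamard space $(H,d)$ with $x_n\to x\in H$. If $X_n$ is drawn from $\{x_1,\dots,x_n\}$ randomly with $\mathbb{P}(X_n=x_k)=p^{(n)}_k$, then $\mathbb{E}(X_n)\to x$.
   Context: A Hadamard space is a complete metric space $(H,d)$ such that for all $x,y\in H$ there is $m\in H$ with $d(z,m)^2\le\frac12 d(z,x)^2+\frac12 d(z,y)^2-\frac14 d(x,y)^2$ for all $z\in H$. For an $H$-valued random variable $X$ with $\mathbb{E}(d(X,z)^2)<\infty$ for some (equivalently all) $z\in H$, $\mathbb{E}(X)\in H$ is the unique minimizer of $z\mapsto\mathbb{E}(d(X,z)^2)$ over $H$; thus here $\mathbb{E}(X_n)$ is the unique minimizer of $z\mapsto\sum_{k=1}^n p_k^{(n)}d(x_k,z)^2$ (points counted with multiplicity). *)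

theory Defs
  imports "HOL-Probability.Probability"
begin

class hadamard_space = complete_space +
  assumes CN_inequality:
    "\<exists>m. \<forall>z. (dist z m)\<^sup>2 \<le> 1 / 2 * (dist z x)\<^sup>2 + 1 / 2 * (dist z y)\<^sup>2 - 1 / 4 * (dist x y)\<^sup>2"

text \<open>
  The expectation of a Borel measurable X with values in a Hadamard space; meaningful only when
  the second moments of the distances are finite, in which case the minimizer exists and is unique.
\<close>
definition hadamard_expectation :: "'b measure \<Rightarrow> ('b \<Rightarrow> 'h :: hadamard_space) \<Rightarrow> 'h" where
  "hadamard_expectation M X =
    (THE z. \<forall>w. (\<integral>\<omega>. (dist (X \<omega>) z)\<^sup>2 \<partial>M) \<le> (\<integral>\<omega>. (dist (X \<omega>) w)\<^sup>2 \<partial>M))"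

text \<open>
  X is drawn from the points x 1, ..., x n with weights q 1, ..., q n.  The points need not be
  distinct, so an atom carries the total weight of all indices at which it occurs.
\<close>
definition drawn_from ::
    "'b measure \<Rightarrow> ('b \<Rightarrow> 'h :: hadamard_space) \<Rightarrow> nat \<Rightarrow> (nat \<Rightarrow> 'h) \<Rightarrow> (nat \<Rightarrow> real) \<Rightarrow> bool" where
  "drawn_from M X n x q \<longleftrightarrow>
    prob_space M \<and> X \<in> borel_measurable M \<and>
    (\<forall>j\<in>{1..n}. \<P>(\<omega> in M. X \<omega> = x j) = (\<Sum>k | k \<in> {1..n} \<and> x k = x j. q k))"

end

theory Submission
  imports Defs
begin

text \<open>
  Let \<open>F(z)\<close> be the mean of the squared distance from \<open>X\<close> to \<open>z\<close>, and \<open>m\<close> its minimizer.  Since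
  \<open>d(l,m)\<^sup>2 \<le> 2 d(x,l)\<^sup>2 + 2 d(x,m)\<^sup>2\<close> for every point \<open>x\<close>, averaging gives
  \<open>d(l,m)\<^sup>2 \<le> 2 F(l) + 2 F(m) \<le> 4 F(l)\<close>.  Now \<open>F(l)\<close> is the weighted mean of the null sequence
  \<open>d(x\<^sub>k, l)\<^sup>2\<close>, and it tends to zero because the weight of every initial segment does (Toeplitz
  summation, \<open>weighted_means_tendsto_zero\<close>).

  Curvature enters only in showing that \<open>m\<close> exists and is unique, so that the definite
  description of the expectation denotes it.  Averaging the CN inequality over the points shows that
  \<open>F\<close> inherits it: between any two points there is one at which \<open>F\<close> drops below the mean of the two
  values by a quarter of their squared distance.  Hence minimizing sequences are Cauchy
  (\<open>ex1_minimizer_if_strongly_midpoint_convex\<close>).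
\<close>

text \<open>
  For a minimizing sequence, the infimum is a lower bound for the value at the approximate midpoint
  of two of its members, so strong convexity bounds their distance by the amount to which their
  values exceed the infimum.
\<close>
lemma ex1_minimizer_if_strongly_midpoint_convex:
  fixes F :: "'a :: complete_space \<Rightarrow> real"
  assumes cont: "continuous_on UNIV F"
    and bdd: "bdd_below (range F)"
    and mid: "\<And>z w. \<exists>m. F m \<le> F z / 2 + F w / 2 - (dist z w)\<^sup>2 / 4"
  shows "\<exists>!z. \<forall>w. F z \<le> F w"
proof -
  define I where "I = (INF z. F z)"
  have I_le: "I \<le> F z" for z
    unfolding I_def using bdd by (simp add: cINF_lower)
  have dist_le: "(dist z w)\<^sup>2 \<le> 2 * F z + 2 * F w - 4 * I" for z w
  proof -
    obtain m where "F m \<le> F z / 2 + F w / 2 - (dist z w)\<^sup>2 / 4"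
      using mid by blast
    with I_le[of m] show ?thesis by linarith
  qed
  have "\<exists>z. F z < I + inverse (real (Suc n))" for n
    using cINF_less_iff[OF _ bdd, of "I + inverse (real (Suc n))"] unfolding I_def by auto
  then obtain s where s: "F (s n) < I + inverse (real (Suc n))" for n
    by metis
  have "Cauchy s"
    unfolding Cauchy_def
  proof (intro allI impI)
    fix e :: real
    assume "e > 0"
    then obtain N where N: "inverse (real (Suc N)) < e\<^sup>2 / 4"
      using reals_Archimedean[of "e\<^sup>2 / 4"] by auto
    have small: "F (s n) - I < e\<^sup>2 / 4" if "n \<ge> N" for n
    proof -
      have "inverse (real (Suc n)) \<le> inverse (real (Suc N))"
        using that by simp
      then show ?thesis using s[of n] N by linarith
    qed
    have "dist (s i) (s j) < e" if "i \<ge> N" "j \<ge> N" for i j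
    proof -
      have "(dist (s i) (s j))\<^sup>2 < e\<^sup>2"
        using dist_le[of "s i" "s j"] small[OF that(1)] small[OF that(2)]
        by (simp add: field_simps)
      then show ?thesis using \<open>e > 0\<close> by (simp add: power2_less_imp_less)
    qed
    then show "\<exists>N. \<forall>i\<ge>N. \<forall>j\<ge>N. dist (s i) (s j) < e" by blast
  qed
  then obtain z where "s \<longlonglongrightarrow> z"
    using Cauchy_convergent convergent_def by blast
  then have Fz: "(\<lambda>n. F (s n)) \<longlonglongrightarrow> F z"
    using cont by (auto intro: continuous_on_tendsto_compose)
  have "(\<lambda>n. I + inverse (real (Suc n))) \<longlonglongrightarrow> I"
    using tendsto_add[OF tendsto_const LIMSEQ_inverse_real_of_nat] by simp
  then have "F z \<le> I"
    using LIMSEQ_le[OF Fz] s less_imp_le by blast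
  then have min_z: "F z \<le> F w" for w
    using I_le order_trans by blast
  show ?thesis
  proof (rule ex1I[of _ z])
    show "\<forall>w. F z \<le> F w" using min_z by blast
    fix y
    assume "\<forall>w. F y \<le> F w"
    then have "F y \<le> I" using \<open>F z \<le> I\<close> order_trans by blast
    then have "(dist y z)\<^sup>2 \<le> 0"
      using dist_le[of y z] \<open>F z \<le> I\<close> by linarith
    then show "y = z" by simp
  qed
qed

lemma ex1_weighted_barycenter:
  fixes x :: "nat \<Rightarrow> 'h :: hadamard_space"
  assumes nonneg: "\<And>k. k \<in> {1..n} \<Longrightarrow> q k \<ge> 0"
    and sum1: "(\<Sum>k=1..n. q k) = (1 :: real)"
  shows "\<exists>!z. \<forall>w. (\<Sum>k=1..n. q k * (dist (x k) z)\<^sup>2) \<le> (\<Sum>k=1..n. q k * (dist (x k) w)\<^sup>2)"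
    (is "\<exists>!z. \<forall>w. ?F z \<le> ?F w")
proof (rule ex1_minimizer_if_strongly_midpoint_convex)
  show "continuous_on UNIV ?F"
    by (intro continuous_intros)
  show "bdd_below (range ?F)"
    using nonneg by (intro bdd_belowI[of _ 0]) (auto intro!: sum_nonneg)
  fix z w :: 'h
  obtain m where m:
    "\<And>y. (dist y m)\<^sup>2 \<le> 1 / 2 * (dist y z)\<^sup>2 + 1 / 2 * (dist y w)\<^sup>2 - 1 / 4 * (dist z w)\<^sup>2"
    using CN_inequality by blast
  have "?F m \<le> (\<Sum>k=1..n. q k * (1 / 2 * (dist (x k) z)\<^sup>2 + 1 / 2 * (dist (x k) w)\<^sup>2
                                    - 1 / 4 * (dist z w)\<^sup>2))"
    using nonneg m by (intro sum_mono mult_left_mono) auto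
  also have "\<dots> = ?F z / 2 + ?F w / 2 - (\<Sum>k=1..n. q k) * (dist z w)\<^sup>2 / 4"
    by (simp add: sum.distrib sum_subtractf sum_distrib_right sum_divide_distrib algebra_simps)
  finally show "\<exists>m. ?F m \<le> ?F z / 2 + ?F w / 2 - (dist z w)\<^sup>2 / 4"
    using sum1 by auto
qed

text \<open>
  The atoms carry the whole mass, so \<open>X\<close> almost surely takes one of finitely many values and
  \<open>g(X)\<close> agrees almost surely with a simple function.
\<close>
lemma drawn_from_integral:
  fixes x :: "nat \<Rightarrow> 'h :: hadamard_space" and g :: "'h \<Rightarrow> real"
  assumes drawn: "drawn_from M X n x q"
    and sum1: "(\<Sum>k=1..n. q k) = 1"
    and cont: "continuous_on UNIV g"
  shows "(\<integral>\<omega>. g (X \<omega>) \<partial>M) = (\<Sum>k=1..n. q k * g (x k))"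
proof -
  interpret prob_space M using drawn by (simp add: drawn_from_def)
  have X[measurable]: "X \<in> borel_measurable M"
    using drawn by (simp add: drawn_from_def)
  define S where "S = x ` {1..n}"
  define A where "A y = {\<omega> \<in> space M. X \<omega> = y}" for y
  have fin: "finite S" by (simp add: S_def)
  have A[measurable]: "A y \<in> sets M" for y
    unfolding A_def using measurable_sets[OF X, of "{y}"]
    by (simp add: vimage_def Int_def conj_commute)
  have prob_A: "prob (A y) = (\<Sum>k | k \<in> {1..n} \<and> x k = y. q k)" if "y \<in> S" for y
    using drawn that by (auto simp: drawn_from_def A_def S_def)
  \<comment> \<open>Regrouping the indices by the point they name turns sums over atoms into sums over indices.\<close>
  have regroup: "(\<Sum>y\<in>S. h y * prob (A y)) = (\<Sum>k=1..n. q k * h (x k))" for h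
  proof -
    have "(\<Sum>y\<in>S. h y * prob (A y))
        = (\<Sum>y\<in>S. \<Sum>k | k \<in> {1..n} \<and> x k = y. q k * h (x k))"
      by (intro sum.cong refl) (simp add: prob_A sum_distrib_left mult.commute)
    also have "\<dots> = (\<Sum>k=1..n. q k * h (x k))"
      by (rule sum.group) (auto simp: S_def)
    finally show ?thesis .
  qed
  have "prob (\<Union>y\<in>S. A y) = (\<Sum>y\<in>S. prob (A y))"
    using fin by (intro finite_measure_finite_Union) (auto simp: disjoint_family_on_def A_def)
  also have "\<dots> = 1"
    using regroup[of "\<lambda>_. 1"] sum1 by simp
  finally have "AE \<omega> in M. \<omega> \<in> (\<Union>y\<in>S. A y)"
    using fin by (intro AE_prob_1)
  then have ae: "AE \<omega> in M. g (X \<omega>) = (\<Sum>y\<in>S. g y * indicator (A y) \<omega>)"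
  proof (rule AE_mp, intro AE_I2 impI)
    fix \<omega>
    assume "\<omega> \<in> space M" and "\<omega> \<in> (\<Union>y\<in>S. A y)"
    then have "X \<omega> \<in> S" by (auto simp: A_def)
    have "(\<Sum>y\<in>S. g y * indicator (A y) \<omega>) = (\<Sum>y\<in>S. if y = X \<omega> then g y else 0)"
      using \<open>\<omega> \<in> space M\<close> by (intro sum.cong) (auto simp: A_def)
    then show "g (X \<omega>) = (\<Sum>y\<in>S. g y * indicator (A y) \<omega>)"
      using fin \<open>X \<omega> \<in> S\<close> by simp
  qed
  have "(\<lambda>\<omega>. g (X \<omega>)) \<in> borel_measurable M"
    using borel_measurable_continuous_onI[OF cont] X by (rule measurable_compose[rotated])
  then have "(\<integral>\<omega>. g (X \<omega>) \<partial>M) = (\<integral>\<omega>. (\<Sum>y\<in>S. g y * indicator (A y) \<omega>) \<partial>M)"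
    using ae by (intro integral_cong_AE) auto
  also have "\<dots> = (\<Sum>y\<in>S. g y * prob (A y))"
    by (simp add: Bochner_Integration.integral_sum less_top[symmetric])
  finally show ?thesis using regroup by simp
qed

lemma hadamard_expectation_minimizes:
  fixes x :: "nat \<Rightarrow> 'h :: hadamard_space"
  assumes nonneg: "\<And>k. k \<in> {1..n} \<Longrightarrow> q k \<ge> 0"
    and sum1: "(\<Sum>k=1..n. q k) = 1"
    and drawn: "drawn_from M X n x q"
  shows "(\<Sum>k=1..n. q k * (dist (x k) (hadamard_expectation M X))\<^sup>2)
       \<le> (\<Sum>k=1..n. q k * (dist (x k) w)\<^sup>2)"
proof -
  have int: "(\<integral>\<omega>. (dist (X \<omega>) z)\<^sup>2 \<partial>M) = (\<Sum>k=1..n. q k * (dist (x k) z)\<^sup>2)" for z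
    by (rule drawn_from_integral[OF drawn sum1]) (intro continuous_intros)
  show ?thesis
    unfolding hadamard_expectation_def int
    using theI'[OF ex1_weighted_barycenter[OF nonneg sum1]] by blast
qed

lemma dist_hadamard_expectation_le:
  fixes x :: "nat \<Rightarrow> 'h :: hadamard_space"
  assumes nonneg: "\<And>k. k \<in> {1..n} \<Longrightarrow> q k \<ge> 0"
    and sum1: "(\<Sum>k=1..n. q k) = 1"
    and drawn: "drawn_from M X n x q"
  shows "(dist (hadamard_expectation M X) l)\<^sup>2 \<le> 4 * (\<Sum>k=1..n. q k * (dist (x k) l)\<^sup>2)"
proof -
  define m where "m = hadamard_expectation M X"
  have dist_sq_le: "(dist m l)\<^sup>2 \<le> 2 * (dist y m)\<^sup>2 + 2 * (dist y l)\<^sup>2" for y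
  proof -
    have "(dist m l)\<^sup>2 \<le> (dist y m + dist y l)\<^sup>2"
      by (intro power_mono) (simp_all add: dist_triangle3)
    also have "\<dots> \<le> 2 * (dist y m)\<^sup>2 + 2 * (dist y l)\<^sup>2"
      using zero_le_power2[of "dist y m - dist y l"] by (simp add: power2_sum power2_diff)
    finally show ?thesis .
  qed
  have "(dist m l)\<^sup>2 = (\<Sum>k=1..n. q k * (dist m l)\<^sup>2)"
    using sum1 by (simp flip: sum_distrib_right)
  also have "\<dots> \<le> (\<Sum>k=1..n. q k * (2 * (dist (x k) m)\<^sup>2 + 2 * (dist (x k) l)\<^sup>2))"
    using nonneg dist_sq_le by (intro sum_mono mult_left_mono) auto
  also have "\<dots> = 2 * (\<Sum>k=1..n. q k * (dist (x k) m)\<^sup>2) + 2 * (\<Sum>k=1..n. q k * (dist (x k) l)\<^sup>2)"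
    by (simp add: sum.distrib sum_distrib_left algebra_simps)
  also have "\<dots> \<le> 4 * (\<Sum>k=1..n. q k * (dist (x k) l)\<^sup>2)"
    using hadamard_expectation_minimizes[OF assms, of l] unfolding m_def by linarith
  finally show ?thesis unfolding m_def .
qed

text \<open>
  A fixed initial segment of the sequence loses all its weight in the limit, and beyond a long
  enough segment the averaged terms are small, since the total weight is one.
\<close>
lemma weighted_means_tendsto_zero:
  fixes p :: "nat \<Rightarrow> nat \<Rightarrow> real" and a :: "nat \<Rightarrow> real"
  assumes nonneg: "\<And>n k. n \<ge> 1 \<Longrightarrow> k \<in> {1..n} \<Longrightarrow> p n k \<ge> 0"
    and sum1: "\<And>n. n \<ge> 1 \<Longrightarrow> (\<Sum>k=1..n. p n k) = 1"
    and lim: "\<And>k. k \<ge> 1 \<Longrightarrow> (\<lambda>n. p n k) \<longlonglongrightarrow> 0"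
    and a: "a \<longlonglongrightarrow> 0"
  shows "(\<lambda>n. \<Sum>k=1..n. p n k * a k) \<longlonglongrightarrow> 0"
proof (rule LIMSEQ_I)
  fix e :: real
  assume "e > 0"
  then obtain N where N: "\<bar>a k\<bar> < e / 2" if "k \<ge> N" for k
    using LIMSEQ_D[OF a, of "e / 2"] by auto
  have "(\<lambda>n. \<Sum>k=1..N. \<bar>p n k * a k\<bar>) \<longlonglongrightarrow> (\<Sum>k=1..N. \<bar>0 * a k\<bar>)"
    using lim by (intro tendsto_sum tendsto_rabs tendsto_mult tendsto_const) auto
  then obtain K where K: "(\<Sum>k=1..N. \<bar>p n k * a k\<bar>) < e / 2" if "n \<ge> K" for n
    using LIMSEQ_D[of _ 0 "e / 2"] \<open>e > 0\<close> by fastforce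
  have "norm ((\<Sum>k=1..n. p n k * a k) - 0) < e" if n: "n \<ge> Suc (max K N)" for n
  proof -
    have term_le: "\<bar>p n k * a k\<bar> \<le> (if k \<in> {1..N} then \<bar>p n k * a k\<bar> else 0) + p n k * (e / 2)"
      if k: "k \<in> {1..n}" for k
    proof (cases "k \<le> N")
      case True
      then show ?thesis using k nonneg[of n k] \<open>e > 0\<close> by simp
    next
      case False
      have "p n k \<ge> 0" using k nonneg[of n k] by simp
      then show ?thesis
        using mult_left_mono[of "\<bar>a k\<bar>" "e / 2" "p n k"] N[of k] False
        by (simp add: abs_mult)
    qed
    have "\<bar>\<Sum>k=1..n. p n k * a k\<bar> \<le> (\<Sum>k=1..n. \<bar>p n k * a k\<bar>)"
      by (rule sum_abs)
    also have "\<dots> \<le> (\<Sum>k=1..n. (if k \<in> {1..N} then \<bar>p n k * a k\<bar> else 0) + p n k * (e / 2))"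
      by (intro sum_mono term_le)
    also have "\<dots> = (\<Sum>k=1..n. if k \<in> {1..N} then \<bar>p n k * a k\<bar> else 0) + e / 2"
      using sum1[of n] n by (simp add: sum.distrib flip: sum_divide_distrib sum_distrib_right)
    also have "(\<Sum>k=1..n. if k \<in> {1..N} then \<bar>p n k * a k\<bar> else 0) = (\<Sum>k=1..N. \<bar>p n k * a k\<bar>)"
      using n by (intro sum.mono_neutral_cong_right) auto
    also have "\<dots> + e / 2 < e"
      using K[of n] n by (simp add: field_simps)
    finally show ?thesis by simp
  qed
  then show "\<exists>no. \<forall>n\<ge>no. norm ((\<Sum>k=1..n. p n k * a k) - 0) < e"
    by blast
qed

theorem lemma3:
  fixes p :: "nat \<Rightarrow> nat \<Rightarrow> real"
    and x :: "nat \<Rightarrow> 'h :: hadamard_space"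
    and l :: 'h
    and M :: "nat \<Rightarrow> 'b measure"
    and X :: "nat \<Rightarrow> 'b \<Rightarrow> 'h"
  assumes p_nonneg: "\<And>n k. n \<ge> 1 \<Longrightarrow> k \<in> {1..n} \<Longrightarrow> p n k \<ge> 0"
    and p_sum: "\<And>n. n \<ge> 1 \<Longrightarrow> (\<Sum>k=1..n. p n k) = 1"
    and p_lim: "\<And>k. k \<ge> 1 \<Longrightarrow> (\<lambda>n. p n k) \<longlonglongrightarrow> 0"
    and x_lim: "x \<longlonglongrightarrow> l"
    and X_drawn: "\<And>n. n \<ge> 1 \<Longrightarrow> drawn_from (M n) (X n) n x (p n)"
  shows "(\<lambda>n. hadamard_expectation (M n) (X n)) \<longlonglongrightarrow> l"
proof -
  let ?d = "\<lambda>n. dist (hadamard_expectation (M n) (X n)) l"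
  let ?F = "\<lambda>n. \<Sum>k=1..n. p n k * (dist (x k) l)\<^sup>2"
  have "(\<lambda>k. (dist (x k) l)\<^sup>2) \<longlonglongrightarrow> 0"
    using tendsto_power[OF iffD1[OF tendsto_dist_iff x_lim], of 2] by simp
  then have "?F \<longlonglongrightarrow> 0"
    using p_nonneg p_sum p_lim by (intro weighted_means_tendsto_zero)
  then have bound: "(\<lambda>n. 4 * ?F n) \<longlonglongrightarrow> 0"
    using tendsto_mult_right_zero by blast
  have "\<forall>\<^sub>F n in sequentially. (?d n)\<^sup>2 \<le> 4 * ?F n"
    using eventually_ge_at_top[of 1]
    by eventually_elim (rule dist_hadamard_expectation_le[OF p_nonneg p_sum X_drawn])
  then have "(\<lambda>n. (?d n)\<^sup>2) \<longlonglongrightarrow> 0"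
    by (intro tendsto_sandwich[OF _ _ tendsto_const bound]) auto
  then have "?d \<longlonglongrightarrow> 0"
    using tendsto_real_sqrt[of "\<lambda>n. (?d n)\<^sup>2"] by simp
  then show ?thesis
    by (rule iffD2[OF tendsto_dist_iff])
qed

end
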